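(* Let $X$ be a closed subset of a space $Y$. (a) If $Y$ is regular and Type I (in itself) with canonical cover $\{V_\alpha : \alpha\in\omega_1\}$, then $Y$ is Tychonoff, each $\overline{V_\alpha}$ is normal, and $Y$ is f-Type I (in itself). (b) If $Y$ is normal and $X$ is Type I in $Y$, then $X$ is f-Type I in $Y$.
   Context: "Space" means Hausdorff topological space; regular, Tychonoff and normal spaces are Hausdorff. All functions are continuous unless stated otherwise. The longray $\mathbb{L}_{\ge 0}$ is $\omega_1\times[0,1)$ with the lexicographic order topology; $\alpha\in\omega_1$ is identified with $\langle\alpha,0\rangle\in\mathbb{L}_{\ge 0}$. A systematic cover of $Y$ indexed by $\omega_1$ is an open cover $\{U_\alpha:\alpha\in\omega_1\}$ with $\overline{U_\alpha}\subset U_\beta$ whenever $\alpha<\beta$. It is good if in addition $U_\alpha=\bigcup_{\gamma<\alpha}U_\gamma$ for every limit $\alpha$. Let $X$ be closed in $Y$. $X$ is Type I in $Y$ if there is a systematic cover $\{U_\alpha:\alpha\in\omega_1\}$ of $Y$ such that $\overline{U_\alpha}\cap X$ is Lindelöf for each $\alpha$; if such a cover is moreover good, it is called a canonical cover of $X$ in $Y$. $X$ is f-Type I (functionally Type I) in $Y$ if there is a continuous $s:Y\to\mathbb{L}_{\ge 0}$ such that $X\cap s^{-1}([0,\alpha])$ is Lindelöf for each $\alpha\in\omega_1$. "In itself" means $X=Y$. *)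

theory Defs
  imports "HOL-Analysis.Analysis"
begin

section \<open>The first uncountable ordinal\<close>

text \<open>\<^const>\<open>cardSuc\<close> \<^const>\<open>natLeq\<close> is the successor cardinal of aleph-zero, presented as a well-order
  all of whose proper initial segments have strictly smaller cardinality. Its order type is
  therefore the least uncountable ordinal; see the lemmas \<open>uncountable_omega1\<close> and
  \<open>countable_lessThan_omega1\<close> below, which characterise it up to order isomorphism.\<close>

typedef omega1 = "Field (cardSuc natLeq)"
  using Field_cardSuc_not_empty[OF natLeq_Card_order] by blast

setup_lifting type_definition_omega1

lemma Well_order_cardSuc_natLeq: "Well_order (cardSuc natLeq)"
  using cardSuc_Card_order[OF natLeq_Card_order] by (simp add: card_order_on_def)

instantiation omega1 :: linorder
begin

lift_definition less_eq_omega1 :: "omega1 \<Rightarrow> omega1 \<Rightarrow> bool"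
  is "\<lambda>x y. (x, y) \<in> cardSuc natLeq" .

definition less_omega1 :: "omega1 \<Rightarrow> omega1 \<Rightarrow> bool"
  where "\<alpha> < \<beta> \<longleftrightarrow> \<alpha> \<le> \<beta> \<and> \<not> \<beta> \<le> (\<alpha>::omega1)"

instance
proof
  have L: "Linear_order (cardSuc natLeq)"
    using Well_order_cardSuc_natLeq by (simp add: well_order_on_def)
  fix x y z :: omega1
  show "x < y \<longleftrightarrow> x \<le> y \<and> \<not> y \<le> x"
    by (rule less_omega1_def)
  show "x \<le> x"
    using L by transfer (auto simp: order_on_defs refl_on_def)
  show "x \<le> z" if "x \<le> y" "y \<le> z"
    using that L by transfer (meson order_on_defs transD)
  show "x = y" if "x \<le> y" "y \<le> x"
    using that L by transfer (meson order_on_defs antisymD)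
  show "x \<le> y \<or> y \<le> x"
    using L by transfer (metis order_on_defs(1-3) refl_onD total_on_def)
qed

end

instance omega1 :: wellorder
proof
  fix P :: "omega1 \<Rightarrow> bool" and a :: omega1
  assume step: "\<And>x. (\<And>y. y < x \<Longrightarrow> P y) \<Longrightarrow> P x"
  have "wf (cardSuc natLeq - Id)"
    using Well_order_cardSuc_natLeq by (simp add: well_order_on_def)
  then have "wf (inv_image (cardSuc natLeq - Id) Rep_omega1)"
    by (rule wf_inv_image)
  then show "P a"
  proof (induction a rule: wf_induct_rule)
    case (less x)
    show ?case
    proof (rule step)
      fix y assume "y < x"
      then have "y \<le> x" "y \<noteq> x" by auto
      then have "(y, x) \<in> inv_image (cardSuc natLeq - Id) Rep_omega1"
        by (simp add: less_eq_omega1.rep_eq Rep_omega1_inject)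
      then show "P y" by (rule less)
    qed
  qed
qed

lemma countable_iff_card_of_natLeq:
  includes cardinal_syntax
  shows "countable A \<longleftrightarrow> |A| \<le>o natLeq"
proof -
  have "countable A \<longleftrightarrow> |A| \<le>o |UNIV :: nat set|"
    by (simp add: countable_def flip: card_of_ordLeq)
  then show ?thesis
    using card_of_nat ordIso_symmetric ordLeq_ordIso_trans by blast
qed

lemma uncountable_omega1: "uncountable (UNIV :: omega1 set)"
  including cardinal_syntax
proof
  assume "countable (UNIV :: omega1 set)"
  then have "countable (range Rep_omega1)" by (rule countable_image)
  then have "|Field (cardSuc natLeq)| \<le>o natLeq"
    by (simp add: type_definition.Rep_range[OF type_definition_omega1] countable_iff_card_of_natLeq)
  moreover have "natLeq <o |Field (cardSuc natLeq)|"
    using cardSuc_greater[OF natLeq_Card_order]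
      card_of_Field_ordIso[OF cardSuc_Card_order[OF natLeq_Card_order]]
    by (meson ordIso_symmetric ordLess_ordIso_trans)
  ultimately show False
    using not_ordLess_ordLeq by blast
qed

lemma countable_lessThan_omega1: "countable {..<\<alpha>::omega1}"
  including cardinal_syntax
proof -
  let ?r = "cardSuc natLeq"
  have "|underS ?r (Rep_omega1 \<alpha>)| <o ?r"
    by (rule card_of_underS[OF cardSuc_Card_order[OF natLeq_Card_order] Rep_omega1])
  then have "countable (underS ?r (Rep_omega1 \<alpha>))"
    by (simp add: countable_iff_card_of_natLeq
        cardSuc_ordLeq_ordLess[OF natLeq_Card_order card_of_Card_order])
  moreover have "Rep_omega1 ` {..<\<alpha>} \<subseteq> underS ?r (Rep_omega1 \<alpha>)"
    by (auto simp: underS_def less_le less_eq_omega1.rep_eq Rep_omega1_inject)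
  ultimately have "countable (Rep_omega1 ` {..<\<alpha>})"
    using countable_subset by blast
  then show ?thesis
    by (meson Rep_omega1_inject countable_image_inj_on inj_onI)
qed

instantiation omega1 :: order_bot
begin

definition bot_omega1 :: omega1
  where "bot = (LEAST \<alpha>::omega1. True)"

instance
  by standard (auto simp: bot_omega1_def intro: Least_le)

end

definition is_limit :: "omega1 \<Rightarrow> bool"
  where "is_limit \<alpha> \<longleftrightarrow> \<alpha> \<noteq> bot \<and> (\<forall>\<beta><\<alpha>. \<exists>\<gamma>. \<beta> < \<gamma> \<and> \<gamma> < \<alpha>)"


section \<open>The longray\<close>

typedef longray = "(UNIV :: omega1 set) \<times> {0..<1::real}"
  by auto

setup_lifting type_definition_longray

instantiation longray :: linorder
begin

lift_definition less_eq_longray :: "longray \<Rightarrow> longray \<Rightarrow> bool"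
  is "\<lambda>p q. fst p < fst q \<or> fst p = fst q \<and> snd p \<le> snd q" .

lift_definition less_longray :: "longray \<Rightarrow> longray \<Rightarrow> bool"
  is "\<lambda>p q. fst p < fst q \<or> fst p = fst q \<and> snd p < snd q" .

instance
  by standard (transfer; force)+

end

instantiation longray :: linorder_topology
begin

definition open_longray :: "longray set \<Rightarrow> bool"
  where "open_longray = generate_topology (range (\<lambda>a. {..< a}) \<union> range (\<lambda>a. {a <..}))"

instance
  by standard (rule open_longray_def)

end

definition longray_of :: "omega1 \<Rightarrow> longray"
  where "longray_of \<alpha> = Abs_longray (\<alpha>, 0)"

instantiation longray :: order_bot
begin

definition bot_longray :: longray
  where "bot = longray_of bot"

instance
proof
  fix a :: longray
  show "bot \<le> a"
    using Rep_longray[of a]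
    by (auto simp: bot_longray_def longray_of_def less_eq_longray.rep_eq Abs_longray_inverse
        less_le)
qed

end


section \<open>Type I and functionally Type I subsets\<close>

definition systematic_cover :: "'a topology \<Rightarrow> (omega1 \<Rightarrow> 'a set) \<Rightarrow> bool"
  where "systematic_cover Y U \<longleftrightarrow>
    (\<forall>\<alpha>. openin Y (U \<alpha>)) \<and> (\<Union>\<alpha>. U \<alpha>) = topspace Y \<and>
    (\<forall>\<alpha> \<beta>. \<alpha> < \<beta> \<longrightarrow> Y closure_of U \<alpha> \<subseteq> U \<beta>)"

definition good_systematic_cover :: "'a topology \<Rightarrow> (omega1 \<Rightarrow> 'a set) \<Rightarrow> bool"
  where "good_systematic_cover Y U \<longleftrightarrow>
    systematic_cover Y U \<and> (\<forall>\<alpha>. is_limit \<alpha> \<longrightarrow> U \<alpha> = (\<Union>\<gamma>\<in>{..<\<alpha>}. U \<gamma>))"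

definition type_I_in :: "'a set \<Rightarrow> 'a topology \<Rightarrow> bool"
  where "type_I_in X Y \<longleftrightarrow> closedin Y X \<and>
    (\<exists>U. systematic_cover Y U \<and>
      (\<forall>\<alpha>. Lindelof_space (subtopology Y (Y closure_of U \<alpha> \<inter> X))))"

definition canonical_cover :: "'a set \<Rightarrow> 'a topology \<Rightarrow> (omega1 \<Rightarrow> 'a set) \<Rightarrow> bool"
  where "canonical_cover X Y U \<longleftrightarrow> closedin Y X \<and> good_systematic_cover Y U \<and>
    (\<forall>\<alpha>. Lindelof_space (subtopology Y (Y closure_of U \<alpha> \<inter> X)))"

definition f_type_I_in :: "'a set \<Rightarrow> 'a topology \<Rightarrow> bool"
  where "f_type_I_in X Y \<longleftrightarrow> closedin Y X \<and>
    (\<exists>s :: 'a \<Rightarrow> longray. continuous_map Y euclidean s \<and>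
      (\<forall>\<alpha>. Lindelof_space (subtopology Y (X \<inter> s -` {bot..longray_of \<alpha>}))))"

end

theory Submission
  imports Defs
begin

text \<open>
  Choose for each \<open>\<alpha>\<close> a continuous \<open>g \<alpha> : Y \<rightarrow> [0,1]\<close> that vanishes on the closure of \<open>U \<alpha>\<close> and
  equals 1 off \<open>U (\<alpha> + 1)\<close>: the closure of \<open>U (\<alpha> + 1)\<close> is normal (in case (a) because it is regular
  and Lindelof), and a Urysohn function on it which is 1 on the boundary extends by 1. The same
  extension from the closure of \<open>V \<alpha>\<close> yields complete regularity in (a). Sending \<open>x\<close> to
  \<open>\<langle>\<alpha>, g \<alpha> x\<rangle>\<close>, where \<open>\<alpha>\<close> is least with \<open>g \<alpha> x < 1\<close>, gives a continuous map \<open>s\<close> to the longray, because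
  \<open>s x \<le> \<langle>\<alpha>, t\<rangle>\<close> holds exactly when \<open>g \<alpha> x \<le> t\<close>, and \<open>s x < \<langle>\<alpha>, t\<rangle>\<close> exactly when \<open>g \<alpha> x < t\<close> or
  \<open>g \<gamma> x < 1\<close> for some \<open>\<gamma> < \<alpha>\<close>.
\<close>

text \<open>A greatest element would exhaust the type by a countable initial segment and one more
  point.\<close>

lemma omega1_no_greatest: "\<exists>\<beta>. (\<alpha>::omega1) < \<beta>"
proof (rule ccontr)
  assume "\<nexists>\<beta>. \<alpha> < \<beta>"
  then have "(UNIV :: omega1 set) = insert \<alpha> {..<\<alpha>}"
    by auto (metis less_linear)
  then show False
    using uncountable_omega1 countable_lessThan_omega1[of \<alpha>] by (metis countable_insert)
qed

definition omega1_succ :: "omega1 \<Rightarrow> omega1"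
  where "omega1_succ \<alpha> = (LEAST \<beta>. \<alpha> < \<beta>)"

lemma less_omega1_succ: "\<alpha> < omega1_succ \<alpha>"
  unfolding omega1_succ_def using omega1_no_greatest by (rule LeastI_ex)

lemma omega1_succ_le: "\<alpha> < \<beta> \<Longrightarrow> omega1_succ \<alpha> \<le> \<beta>"
  unfolding omega1_succ_def by (rule Least_le)

lemma Abs_longray_le_iff:
  assumes "0 \<le> t" "t < 1" "0 \<le> u" "u < 1"
  shows "Abs_longray (\<alpha>, t) \<le> Abs_longray (\<beta>, u) \<longleftrightarrow> \<alpha> < \<beta> \<or> \<alpha> = \<beta> \<and> t \<le> u"
  using assms by (simp add: less_eq_longray.rep_eq Abs_longray_inverse)

lemma Abs_longray_less_iff:
  assumes "0 \<le> t" "t < 1" "0 \<le> u" "u < 1"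
  shows "Abs_longray (\<alpha>, t) < Abs_longray (\<beta>, u) \<longleftrightarrow> \<alpha> < \<beta> \<or> \<alpha> = \<beta> \<and> t < u"
  using assms by (simp add: less_longray.rep_eq Abs_longray_inverse)

lemma longray_cases:
  obtains \<alpha> t where "p = Abs_longray (\<alpha>, t)" "0 \<le> t" "t < 1"
  by (cases p) (auto simp: mem_Times_iff)

text \<open>By \<open>step\<close>, at each point of the space the family stays at 1, then takes its
  first value below 1, and is 0 at all later indices. So \<open>g \<alpha>\<close> acts as the
  coordinate of \<open>s\<close> clamped to the interval from \<alpha> to its successor.\<close>

lemma continuous_map_longray_of_family:
  fixes g :: "omega1 \<Rightarrow> 'a \<Rightarrow> real"
  assumes cont: "\<And>\<alpha>. continuous_map Y (top_of_set {0..1}) (g \<alpha>)"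
    and step: "\<And>\<gamma> \<alpha> x. \<lbrakk>x \<in> topspace Y; \<gamma> < \<alpha>; g \<gamma> x < 1\<rbrakk> \<Longrightarrow> g \<alpha> x = 0"
    and ex: "\<And>x. x \<in> topspace Y \<Longrightarrow> \<exists>\<alpha>. g \<alpha> x < 1"
  obtains s :: "'a \<Rightarrow> longray" where "continuous_map Y euclidean s"
    and "\<And>x \<alpha>. x \<in> topspace Y \<Longrightarrow> s x \<le> longray_of \<alpha> \<longleftrightarrow> g \<alpha> x \<le> 0"
proof
  \<comment> \<open>Off \<open>topspace Y\<close> this index may be meaningless; every fact about
    \<open>s\<close> below is confined to points of the space.\<close>
  define a where "a = (\<lambda>x. LEAST \<alpha>. g \<alpha> x < 1)"
  define s where "s = (\<lambda>x. Abs_longray (a x, g (a x) x))"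
  have g01: "0 \<le> g \<alpha> x" "g \<alpha> x \<le> 1" if "x \<in> topspace Y" for \<alpha> x
    using cont[of \<alpha>] that by (auto simp: continuous_map_in_subtopology Pi_iff)
  have contg: "continuous_map Y euclideanreal (g \<alpha>)" for \<alpha>
    using cont[of \<alpha>] by (simp add: continuous_map_in_subtopology)
  have ga: "g (a x) x < 1" if "x \<in> topspace Y" for x
    unfolding a_def using ex[OF that] by (rule LeastI_ex)
  have a_least: "a x \<le> \<alpha>" if "g \<alpha> x < 1" for x \<alpha>
    unfolding a_def using that by (rule Least_le)
  have le_iff: "s x \<le> Abs_longray (\<alpha>, t) \<longleftrightarrow> g \<alpha> x \<le> t"
    if x: "x \<in> topspace Y" and t: "0 \<le> t" "t < 1" for x \<alpha> t
  proof -
    \<comment> \<open>If \<open>a x < \<alpha>\<close>, then \<open>step\<close> gives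
      \<open>g \<alpha> x = 0\<close> and both sides hold. If \<open>\<alpha> < a x\<close>,
      minimality gives \<open>g \<alpha> x = 1 > t\<close> and both fail.\<close>
    consider "a x < \<alpha>" | "a x = \<alpha>" | "\<alpha> < a x" by fastforce
    then show ?thesis
    proof cases
      case 1
      then show ?thesis
        using step[OF x 1 ga[OF x]] t g01[OF x] ga[OF x] by (simp add: s_def Abs_longray_le_iff)
    next
      case 2
      then show ?thesis
        using t g01[OF x] ga[OF x] by (auto simp: s_def Abs_longray_le_iff)
    next
      case 3
      then have "\<not> g \<alpha> x < 1" using a_least[of \<alpha> x] by auto
      then show ?thesis
        using 3 t g01[OF x] ga[OF x] by (auto simp: s_def Abs_longray_le_iff)
    qed
  qed
  have less_iff: "s x < Abs_longray (\<alpha>, t) \<longleftrightarrow> g \<alpha> x < t \<or> (\<exists>\<gamma><\<alpha>. g \<gamma> x < 1)"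
    if x: "x \<in> topspace Y" and t: "0 \<le> t" "t < 1" for x \<alpha> t
  proof -
    have "s x < Abs_longray (\<alpha>, t) \<longleftrightarrow> a x < \<alpha> \<or> a x = \<alpha> \<and> g \<alpha> x < t"
      using t g01[OF x] ga[OF x] by (auto simp: s_def Abs_longray_less_iff)
    moreover have "a x < \<alpha> \<longleftrightarrow> (\<exists>\<gamma><\<alpha>. g \<gamma> x < 1)"
      using ga[OF x] a_least[of _ x] by (meson le_less_trans)
    \<comment> \<open>This serves the direction from right to left: \<open>g \<alpha> x < t\<close>
      leaves \<open>a x = \<alpha>\<close> or \<open>a x < \<alpha>\<close>, and either puts
      \<open>s x\<close> below the given point.\<close>
    moreover have "a x \<le> \<alpha>" if "g \<alpha> x < t"
      using that t a_least[of \<alpha> x] by simp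
    ultimately show ?thesis
      by (auto simp: le_less)
  qed
  show "continuous_map Y euclidean s"
    unfolding continuous_map_upper_lower_semicontinuous_lt
  proof (intro conjI allI)
    fix p
    obtain \<alpha> t where p: "p = Abs_longray (\<alpha>, t)" and t: "0 \<le> t" "t < 1"
      by (rule longray_cases)
    have "{x \<in> topspace Y. p < s x} = {x \<in> topspace Y. t < g \<alpha> x}"
      using le_iff[OF _ t] by (auto simp: p simp flip: not_le)
    then show "openin Y {x \<in> topspace Y. p < s x}"
      using contg[of \<alpha>] by (simp add: continuous_map_upper_lower_semicontinuous_lt)
    \<comment> \<open>For \<open>t = 0\<close> the first set is empty, since \<open>g\<close> is
      nonnegative, and the union supplies all points mapped below \<alpha>. This treats limits and
      successors alike.\<close>
    have "{x \<in> topspace Y. s x < p} =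
        {x \<in> topspace Y. g \<alpha> x < t} \<union> (\<Union>\<gamma>\<in>{..<\<alpha>}. {x \<in> topspace Y. g \<gamma> x < 1})"
      using less_iff[OF _ t] by (auto simp: p)
    moreover have "openin Y {x \<in> topspace Y. g \<gamma> x < u}" for \<gamma> u
      using contg[of \<gamma>] by (simp add: continuous_map_upper_lower_semicontinuous_lt)
    ultimately show "openin Y {x \<in> topspace Y. s x < p}"
      by (auto intro!: openin_Un openin_Union)
  qed
  show "s x \<le> longray_of \<alpha> \<longleftrightarrow> g \<alpha> x \<le> 0" if "x \<in> topspace Y" for x \<alpha>
    using le_iff[OF that, of 0] by (simp add: longray_of_def)
qed

text \<open>Normality enters only inside the closure of \<open>V\<close>. The lemma is used twice:
  between consecutive members of a cover, and around a single point to separate it from a closed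
  set.\<close>

lemma Urysohn_within_open:
  assumes V: "openin Y V" and normal: "normal_space (subtopology Y (Y closure_of V))"
    and S: "closedin Y S" "S \<subseteq> V"
  obtains g where "continuous_map Y (top_of_set {0..1::real}) g"
    "\<And>x. x \<in> S \<Longrightarrow> g x = 0" "\<And>x. x \<notin> V \<Longrightarrow> g x = 1"
proof -
  let ?C = "Y closure_of V"
  have VC: "V \<subseteq> ?C"
    using V by (simp add: closure_of_subset openin_subset)
  have "closedin (subtopology Y ?C) S"
    using S VC by (meson closedin_subset_topspace subset_trans)
  moreover have "closedin (subtopology Y ?C) (?C - V)"
    using V by (simp add: closedin_diff closedin_subset_topspace)
  moreover have "disjnt S (?C - V)"
    using S by (auto simp: disjnt_def)
  ultimately obtain f where f: "continuous_map (subtopology Y ?C) (top_of_set {0..1::real}) f"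
    and f0: "f ` S \<subseteq> {0}" and f1: "f ` (?C - V) \<subseteq> {1}"
    using Urysohn_lemma[OF normal, of S "?C - V" 0 1] by auto
  show ?thesis
  proof
    \<comment> \<open>The two branches meet on the frontier of \<open>V\<close>, where
      \<open>f\<close> is already 1. The default 1 also covers points outside
      \<open>topspace Y\<close>, so \<open>g x = 1\<close> holds off \<open>V\<close> without a side
      condition.\<close>
    show "continuous_map Y (top_of_set {0..1}) (\<lambda>x. if x \<in> V then f x else 1)"
    proof (rule continuous_map_cases)
      show "f x = 1" if "x \<in> Y frontier_of {x. x \<in> V}" for x
        using that f1 V by (auto simp: frontier_of_def interior_of_openin)
    qed (use f in auto)
  qed (use f0 S in auto)
qed

text \<open>This is the common core of both cases: (a) takes the whole space for \<open>X\<close>,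
  and the cases differ only in why the closures are normal.\<close>

lemma f_type_I_in_of_normal_closures:
  assumes X: "closedin Y X" and cover: "systematic_cover Y U"
    and Lin: "\<And>\<alpha>. Lindelof_space (subtopology Y (Y closure_of U \<alpha> \<inter> X))"
    and normal: "\<And>\<alpha>. normal_space (subtopology Y (Y closure_of U \<alpha>))"
  shows "f_type_I_in X Y"
proof -
  let ?S = omega1_succ
  have openU: "openin Y (U \<alpha>)" for \<alpha>
    using cover by (simp add: systematic_cover_def)
  have closU: "Y closure_of U \<alpha> \<subseteq> U \<beta>" if "\<alpha> < \<beta>" for \<alpha> \<beta>
    using cover that by (simp add: systematic_cover_def)
  have subU: "U \<alpha> \<subseteq> Y closure_of U \<alpha>" for \<alpha>
    using openU by (simp add: closure_of_subset openin_subset)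
  have "\<exists>g. continuous_map Y (top_of_set {0..1::real}) g \<and>
      (\<forall>x \<in> Y closure_of U \<alpha>. g x = 0) \<and> (\<forall>x. x \<notin> U (?S \<alpha>) \<longrightarrow> g x = 1)" for \<alpha>
    using Urysohn_within_open[OF openU normal closedin_closure_of closU[OF less_omega1_succ[of \<alpha>]]]
    by (metis (no_types, lifting))
  then obtain g where contg: "\<And>\<alpha>. continuous_map Y (top_of_set {0..1::real}) (g \<alpha>)"
    and g0: "\<And>\<alpha> x. x \<in> Y closure_of U \<alpha> \<Longrightarrow> g \<alpha> x = 0"
    and g1: "\<And>\<alpha> x. x \<notin> U (?S \<alpha>) \<Longrightarrow> g \<alpha> x = 1"
    by metis
  have step: "g \<alpha> x = 0" if "\<gamma> < \<alpha>" "g \<gamma> x < 1" for \<gamma> \<alpha> x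
  proof -
    \<comment> \<open>The successor of \<gamma> is at most \<alpha>, so \<open>x\<close> already
      lies in the closure of \<open>U \<alpha>\<close>, where \<open>g \<alpha>\<close>
      vanishes.\<close>
    have "x \<in> U (?S \<gamma>)" using g1[of x \<gamma>] that by (cases "x \<in> U (?S \<gamma>)") auto
    then have "x \<in> Y closure_of U \<alpha>"
      using omega1_succ_le[OF that(1)] closU[of "?S \<gamma>" \<alpha>] subU[of "?S \<gamma>"] subU[of \<alpha>]
      by (cases "?S \<gamma> = \<alpha>") (auto simp: less_le)
    then show ?thesis by (rule g0)
  qed
  have ex: "\<exists>\<alpha>. g \<alpha> x < 1" if "x \<in> topspace Y" for x
  proof -
    obtain \<alpha> where "x \<in> U \<alpha>"
      using cover \<open>x \<in> topspace Y\<close> unfolding systematic_cover_def by blast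
    then have "g \<alpha> x = 0" using g0 subU by blast
    then show ?thesis by (intro exI[of _ \<alpha>]) simp
  qed
  obtain s :: "'a \<Rightarrow> longray" where conts: "continuous_map Y euclidean s"
    and s: "\<And>x \<alpha>. x \<in> topspace Y \<Longrightarrow> s x \<le> longray_of \<alpha> \<longleftrightarrow> g \<alpha> x \<le> 0"
  proof (rule continuous_map_longray_of_family[of Y g])
    show "continuous_map Y (top_of_set {0..1}) (g \<alpha>)" for \<alpha> by (rule contg)
    show "g \<alpha> x = 0" if "\<gamma> < \<alpha>" "g \<gamma> x < 1" for \<gamma> \<alpha> x using that by (rule step)
    show "\<exists>\<alpha>. g \<alpha> x < 1" if "x \<in> topspace Y" for x using that by (rule ex)
  qed (rule that)
  have "Lindelof_space (subtopology Y (X \<inter> s -` {bot..longray_of \<alpha>}))" for \<alpha>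
  proof -
    \<comment> \<open>The bound \<open>s x \<le> longray_of \<alpha>\<close> only forces
      \<open>x\<close> into the next member of the cover, hence the successor index in
      \<open>?B\<close>. Being closed in the Lindelof set \<open>?B\<close>, \<open>?A\<close> is
      Lindelof.\<close>
    let ?A = "X \<inter> s -` {bot..longray_of \<alpha>}" and ?B = "Y closure_of U (?S \<alpha>) \<inter> X"
    have XY: "X \<subseteq> topspace Y" using X by (rule closedin_subset)
    then have "?A = X \<inter> {x \<in> topspace Y. s x \<in> {bot..longray_of \<alpha>}}" by auto
    moreover have "closedin Y {x \<in> topspace Y. s x \<in> {bot..longray_of \<alpha>}}"
      by (rule closedin_continuous_map_preimage[OF conts]) simp
    ultimately have "closedin Y ?A"
      using X by (metis closedin_Int)
    moreover have AB: "?A \<subseteq> ?B"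
    proof
      fix x assume x: "x \<in> ?A"
      then have "g \<alpha> x \<le> 0" using s XY by auto
      then have "x \<in> U (?S \<alpha>)" using g1[of x \<alpha>] by (cases "x \<in> U (?S \<alpha>)") auto
      then show "x \<in> ?B" using x subU by blast
    qed
    ultimately have "closedin (subtopology Y ?B) ?A"
      by (simp add: closedin_subset_topspace)
    from Lindelof_space_closedin_subtopology[OF Lin this] show ?thesis
      by (metis AB inf.absorb2 subtopology_subtopology)
  qed
  then show ?thesis
    using X conts by (auto simp: f_type_I_in_def)
qed

lemma completely_regular_of_normal_cover:
  assumes T1: "t1_space Y" and cover: "topspace Y \<subseteq> (\<Union>\<alpha>\<in>I. V \<alpha>)"
    and V: "\<And>\<alpha>. \<alpha> \<in> I \<Longrightarrow> openin Y (V \<alpha>)"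
    and normal: "\<And>\<alpha>. \<alpha> \<in> I \<Longrightarrow> normal_space (subtopology Y (Y closure_of V \<alpha>))"
  shows "completely_regular_space Y"
  unfolding completely_regular_space_def
proof (intro allI impI, elim conjE)
  fix C x assume C: "closedin Y C" and x: "x \<in> topspace Y - C"
  obtain \<alpha> where \<alpha>: "\<alpha> \<in> I" "x \<in> V \<alpha>"
    using cover x by blast
  \<comment> \<open>With \<open>C\<close> removed, a function equal to 1 off \<open>?W\<close> is 1
    on all of \<open>C\<close>; the smaller closure stays normal as a closed subspace.\<close>
  let ?W = "V \<alpha> - C"
  have W: "Y closure_of ?W \<subseteq> Y closure_of V \<alpha>"
    by (simp add: closure_of_mono)
  have "closedin (subtopology Y (Y closure_of V \<alpha>)) (Y closure_of ?W)"
    using W by (simp add: closedin_subset_topspace)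
  from normal_space_closed_subtopology[OF normal[OF \<alpha>(1)] this]
  have "normal_space (subtopology Y (Y closure_of ?W))"
    using W by (simp add: subtopology_subtopology inf.absorb2)
  moreover have "openin Y ?W"
    using V[OF \<alpha>(1)] C by (rule openin_diff)
  moreover have "closedin Y {x}"
    using T1 x by (simp add: closedin_t1_singleton)
  ultimately obtain g where "continuous_map Y (top_of_set {0..1::real}) g"
    "g x = 0" "\<And>y. y \<notin> ?W \<Longrightarrow> g y = 1"
    using Urysohn_within_open[of Y ?W "{x}"] x \<alpha> by auto
  then show "\<exists>f. continuous_map Y (top_of_set {0..1::real}) f \<and> f x = 0 \<and> f ` C \<subseteq> {1}"
    by (intro exI[of _ g]) auto
qed

theorem lemma2p3:
  fixes Y :: "'a topology" and X :: "'a set"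
  assumes "Hausdorff_space Y"
    and "closedin Y X"
  shows "(\<forall>V. regular_space Y \<and> type_I_in (topspace Y) Y \<and> canonical_cover (topspace Y) Y V \<longrightarrow>
            (completely_regular_space Y \<and> Hausdorff_space Y) \<and>
            (\<forall>\<alpha>. normal_space (subtopology Y (Y closure_of V \<alpha>)) \<and>
                 Hausdorff_space (subtopology Y (Y closure_of V \<alpha>))) \<and>
            f_type_I_in (topspace Y) Y)
       \<and> (normal_space Y \<and> type_I_in X Y \<longrightarrow> f_type_I_in X Y)"
proof (intro conjI allI impI)
  fix V
  assume "regular_space Y \<and> type_I_in (topspace Y) Y \<and> canonical_cover (topspace Y) Y V"
  then have reg: "regular_space Y" and cover: "systematic_cover Y V"
    and Lin: "\<And>\<alpha>. Lindelof_space (subtopology Y (Y closure_of V \<alpha> \<inter> topspace Y))"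
    by (auto simp: canonical_cover_def good_systematic_cover_def)
  show normal: "normal_space (subtopology Y (Y closure_of V \<alpha>))" for \<alpha>
  proof (rule regular_Lindelof_imp_normal_space)
    show "Lindelof_space (subtopology Y (Y closure_of V \<alpha>))"
      using Lin[of \<alpha>] by (simp add: inf.absorb1 closure_of_subset_topspace)
  qed (simp add: reg regular_space_subtopology)
  show "Hausdorff_space Y" by fact
  show "Hausdorff_space (subtopology Y (Y closure_of V \<alpha>))" for \<alpha>
    using assms(1) by (rule Hausdorff_space_subtopology)
  show "completely_regular_space Y"
    using completely_regular_of_normal_cover[where I = UNIV and V = V] cover normal assms(1)
    by (auto simp: Hausdorff_imp_t1_space systematic_cover_def)
  show "f_type_I_in (topspace Y) Y"
    using cover Lin normal by (intro f_type_I_in_of_normal_closures) auto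
next
  assume "normal_space Y \<and> type_I_in X Y"
  then obtain U where normal: "normal_space Y" and U: "systematic_cover Y U"
    "\<And>\<alpha>. Lindelof_space (subtopology Y (Y closure_of U \<alpha> \<inter> X))"
    by (auto simp: type_I_in_def)
  \<comment> \<open>Here the closures of the cover are normal as closed subspaces of the normal
    space \<open>Y\<close>.\<close>
  then show "f_type_I_in X Y"
    using assms(2)
    by (intro f_type_I_in_of_normal_closures) (auto intro: normal_space_closed_subtopology)
qed

end
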